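(* Let $p\in\mathbb{R}[x]$ be a polynomial of degree $m\ge 1$. Then $B(p)\le m$.
   Context: A full branch interval for a polynomial $p\in\mathbb{R}[x]$ of degree $m\ge 1$ is an open interval $I\subset\mathbb{R}$ such that $p:I\to(-1,1)$ is a $C^1$ diffeomorphism (onto). $B(p)$ denotes the number of full branch intervals of $p$. *)

theory Defs
  imports "HOL-Analysis.Analysis" "HOL-Computational_Algebra.Polynomial"
begin

(* C1_differentiable_on uses two-sided derivatives, so on the open sets I and J it is
   exactly "continuously differentiable". inv_into I f is the inverse J -> I of the bijection. *)
definition C1_diffeomorphism :: "real set \<Rightarrow> real set \<Rightarrow> (real \<Rightarrow> real) \<Rightarrow> bool" where
  "C1_diffeomorphism I J f \<longleftrightarrow>
     open I \<and> open J \<and> bij_betw f I J \<and>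
     f C1_differentiable_on I \<and> inv_into I f C1_differentiable_on J"

(* The interval I may a priori be unbounded; it is nonempty since it is mapped onto (-1,1). *)
definition full_branch_interval :: "real poly \<Rightarrow> real set \<Rightarrow> bool" where
  "full_branch_interval p I \<longleftrightarrow>
     open I \<and> is_interval I \<and> C1_diffeomorphism I {-1<..<1} (poly p)"

definition full_branch_intervals :: "real poly \<Rightarrow> real set set" where
  "full_branch_intervals p = {I. full_branch_interval p I}"

(* card is 0 on infinite sets, so a bound on B p is meaningful only together with
   finiteness of full_branch_intervals p. *)
definition B :: "real poly \<Rightarrow> nat" where
  "B p = card (full_branch_intervals p)"

end

theory Submission
  imports Defs
begin

text \<open>Distinct full branch intervals are disjoint: if \<open>J\<close> is one of them with inverse
  branch \<open>g\<close>, then any other one \<open>I\<close> meets \<open>J\<close> in the set of \<open>x \<in> I\<close> with \<open>g (p x) = x\<close>,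
  which is open and closed in the connected set \<open>I\<close>. As every full branch interval contains
  a zero of \<open>p\<close>, there are at most as many of them as there are zeros.\<close>

lemma connected_subset_of_open_embedding:
  fixes f g :: "'a::real_normed_vector \<Rightarrow> 'a"
  assumes "connected I" "continuous_on I f" "f ` I \<subseteq> V"
    and "open J" "continuous_on V g" "g ` V \<subseteq> J" "\<And>x. x \<in> J \<Longrightarrow> g (f x) = x"
    and "I \<inter> J \<noteq> {}"
  shows "I \<subseteq> J"
proof -
  \<comment> \<open>A point of \<open>I\<close> fixed by \<open>g\<close> after \<open>f\<close>
    lies in \<open>J\<close> because \<open>g\<close> takes its values there. Writing the fixed
    points as zeros of a difference makes relative closedness a matter of continuity.\<close>
  have fixpoints: "I \<inter> J = {x \<in> I. g (f x) - x = 0}"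
  proof (intro equalityI subsetI)
    fix x
    assume "x \<in> {x \<in> I. g (f x) - x = 0}"
    moreover from this have "g (f x) \<in> J"
      using assms(3,6) by blast
    ultimately show "x \<in> I \<inter> J"
      by simp
  qed (use assms(7) in auto)
  have "continuous_on I (\<lambda>x. g (f x) - x)"
    by (intro continuous_on_diff continuous_on_id continuous_on_compose2[OF assms(5,2,3)])
  then have "closedin (top_of_set I) (I \<inter> J)"
    unfolding fixpoints by (rule continuous_closedin_preimage_constant)
  moreover have "openin (top_of_set I) (I \<inter> J)"
    using \<open>open J\<close> by (rule openin_open_Int)
  ultimately show ?thesis
    using assms(1,8) unfolding connected_clopen by blast
qed

text \<open>Both intervals have the same image (-1,1), so the inverse branch on \<open>J\<close> can
  be applied to \<open>p\<close> on all of \<open>I\<close>. Exchanging \<open>I\<close> and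
  \<open>J\<close> gives equality.\<close>

lemma full_branch_interval_subset:
  assumes "full_branch_interval p I" "full_branch_interval p J" "I \<inter> J \<noteq> {}"
  shows "I \<subseteq> J"
proof (rule connected_subset_of_open_embedding)
  show "connected I"
    using assms by (simp add: full_branch_interval_def is_interval_connected)
  show "poly p ` I \<subseteq> {-1<..<1}"
    using assms by (auto simp: full_branch_interval_def C1_diffeomorphism_def bij_betw_def)
  have bij: "bij_betw (poly p) J {-1<..<1}"
    using assms by (simp add: full_branch_interval_def C1_diffeomorphism_def)
  show "inv_into J (poly p) ` {-1<..<1} \<subseteq> J"
    using bij_betw_inv_into[OF bij] by (simp add: bij_betw_def)
  show "inv_into J (poly p) (poly p x) = x" if "x \<in> J" for x
    using bij that by (rule bij_betw_inv_into_left)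
  show "continuous_on {-1<..<1} (inv_into J (poly p))"
    using assms
    by (simp add: full_branch_interval_def C1_diffeomorphism_def C1_differentiable_imp_continuous_on)
  show "continuous_on I (poly p)"
    by (intro continuous_on_poly continuous_on_id)
qed (use assms in \<open>simp_all add: full_branch_interval_def\<close>)

theorem lemma4:
  fixes p :: "real poly" and m :: nat
  assumes "degree p = m" and "m \<ge> 1"
  shows "finite (full_branch_intervals p) \<and> B p \<le> m"
proof -
  define Z where "Z = {x. poly p x = 0}"
  \<comment> \<open>The zero polynomial has degree 0, whereas \<open>m \<ge> 1\<close>.\<close>
  have "p \<noteq> 0"
    using assms by auto
  then have Z: "finite Z" "card Z \<le> m"
    using assms poly_roots_finite[of p] card_poly_roots_bound[of p] by (auto simp: Z_def)
  have "\<exists>x \<in> I. poly p x = 0" if "I \<in> full_branch_intervals p" for I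
  proof -
    \<comment> \<open>The value 0 lies in (-1,1), the image of \<open>I\<close>.\<close>
    have "0 \<in> poly p ` I"
      using that by (simp add: full_branch_intervals_def full_branch_interval_def
          C1_diffeomorphism_def bij_betw_def)
    then show ?thesis
      by force
  qed
  then obtain zero where zero:
    "\<And>I. I \<in> full_branch_intervals p \<Longrightarrow> zero I \<in> I \<and> poly p (zero I) = 0"
    by metis
  have sub: "zero ` full_branch_intervals p \<subseteq> Z"
    using zero by (auto simp: Z_def)
  have inj: "inj_on zero (full_branch_intervals p)"
  proof (rule inj_onI)
    fix I J
    assume IJ: "I \<in> full_branch_intervals p" "J \<in> full_branch_intervals p" "zero I = zero J"
    then have "I \<inter> J \<noteq> {}"
      using zero by (metis IntI empty_iff)
    then show "I = J"
      using IJ full_branch_interval_subset[of p I J] full_branch_interval_subset[of p J I]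
      by (auto simp: full_branch_intervals_def)
  qed
  \<comment> \<open>The injection \<open>zero\<close> into the finite set \<open>Z\<close> yields
    both finiteness and the cardinality bound.\<close>
  show ?thesis
    using inj_on_finite[OF inj sub Z(1)] card_inj_on_le[OF inj sub Z(1)] Z(2)
    by (simp add: B_def)
qed

end
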